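(* Let $q$ be an odd prime power, $h\in\mathcal A^+$ and $m\ge0$ an integer. If $d(h)$ is even, then $$\sum_{H\in\mathcal A^+_m}\psi_h(H)=\frac{q^m}{|h|}\Biggl(\mathcal G(0,\psi_h)+(q-1)\sum_{V\in\mathcal A^+_{\le d(h)-m-2}}\mathcal G(V,\psi_h)-\sum_{V\in\mathcal A^+_{d(h)-m-1}}\mathcal G(V,\psi_h)\Biggr).$$ If $d(h)$ is odd, then $$\sum_{H\in\mathcal A^+_m}\psi_h(H)=\frac{q^m\sqrt q}{|h|}\sum_{V\in\mathcal A^+_{d(h)-m-1}}\mathcal G(V,\psi_h).$$
   Context: $\mathcal A=\mathbb F_q[x]$; $\mathcal A^+$ is the set of monic polynomials; $d(f)=\deg f$, $|f|=q^{d(f)}$; $\mathcal A_n^+$ and $\mathcal A_{\le n}^+$ are the sets of monic polynomials of degree $n$ and of degree at most $n$ (both empty if $n<0$). For $f\in\mathcal A^+$, $\psi_f(a):=\left(\frac af\right)$ is the Jacobi symbol over $\mathcal A$: for $P$ monic irreducible, $\left(\frac aP\right)\in\{0,\pm1\}$ with $\left(\frac aP\right)\equiv a^{(|P|-1)/2}\bmod P$, extended multiplicatively in the lower entry, with $\left(\frac a1\right)=1$. Let $p=\operatorname{char}\mathbb F_q$, $e_p(\alpha)=\exp(2\pi i\operatorname{Tr}_{\mathbb F_q/\mathbb F_p}(\alpha)/p)$, $\chi_2$ the quadratic character of $\mathbb F_q^\times$, $g_1=\sum_{\alpha\in\mathbb F_q^\times}\chi_2(\alpha)e_p(\alpha)$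 and $\varepsilon_q=g_1/\sqrt q$. For $a\in\mathbb F_q((x^{-1}))$, $e(a):=e_p([x^{-1}]a)$, where $[x^{-1}]a$ is the coefficient of $x^{-1}$. Let $\nu(h)\in\{0,1\}$ be the parity of $d(h)$. The phase-normalized Gauss sum is $$\mathcal G(V,\psi_h):=\overline{\varepsilon_q}^{\,\nu(h)}\sum_{u\bmod h}\psi_h(u)\,e\!\left(\frac{uV}{h}\right)\qquad(h\in\mathcal A^+,\ V\in\mathcal A).$$ *)

theory Defs
  imports
    Complex_Main
    "HOL-Library.Cardinality"
    "HOL-Computational_Algebra.Polynomial_Factorial"
    "HOL-Computational_Algebra.Formal_Laurent_Series"
    "HOL-Number_Theory.Cong"
begin

text \<open>
  The finite field \<open>F\<^sub>q\<close> is an arbitrary type \<open>'a\<close> of sort \<open>{field, finite}\<close>, with \<open>q = CARD('a)\<close>.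
\<close>

abbreviation monic :: "'a::{field,finite} poly \<Rightarrow> bool" where
  "monic f \<equiv> lead_coeff f = 1"

definition pabs :: "'a::{field,finite} poly \<Rightarrow> nat" where
  "pabs f = CARD('a) ^ degree f"

text \<open>The degree bounds are integers, so that both sets are empty for negative bounds.\<close>

definition monics_deg :: "int \<Rightarrow> 'a::{field,finite} poly set" where
  "monics_deg n = {f. monic f \<and> int (degree f) = n}"

definition monics_deg_le :: "int \<Rightarrow> 'a::{field,finite} poly set" where
  "monics_deg_le n = {f. monic f \<and> int (degree f) \<le> n}"

text \<open>
  The symbol \<open>(a/P)\<close> for \<open>P\<close> monic irreducible. For odd \<open>q\<close> the elements \<open>-1, 0, 1\<close> are pairwise
  incongruent modulo \<open>P\<close>, so the description picks out a unique integer.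
\<close>

definition legendre_symbol :: "'a::{field,finite} poly \<Rightarrow> 'a poly \<Rightarrow> int" where
  "legendre_symbol a P =
     (THE s. s \<in> {-1, 0, 1} \<and> [a ^ ((pabs P - 1) div 2) = of_int s] (mod P))"

text \<open>
  The library constant \<open>multiplicity\<close> is available for polynomials only over coefficient types of
  sort \<open>factorial_ring_gcd\<close>, which the sort \<open>field\<close> does not provide.
\<close>

definition poly_multiplicity :: "'a::{field,finite} poly \<Rightarrow> 'a poly \<Rightarrow> nat" where
  "poly_multiplicity P f = Max {n. P ^ n dvd f}"

definition jacobi_symbol :: "'a::{field,finite} poly \<Rightarrow> 'a poly \<Rightarrow> int" where
  "jacobi_symbol a f =
     (\<Prod>P | monic P \<and> irreducible P \<and> P dvd f. legendre_symbol a P ^ poly_multiplicity P f)"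

definition psi :: "'a::{field,finite} poly \<Rightarrow> 'a poly \<Rightarrow> complex" where
  "psi f a = of_int (jacobi_symbol a f)"

text \<open>The degree of \<open>F\<^sub>q\<close> over its prime field.\<close>

definition ext_degree :: "'a::{field,finite} itself \<Rightarrow> nat" where
  "ext_degree _ = (THE n. CARD('a) = CHAR('a) ^ n)"

text \<open>The trace from \<open>F\<^sub>q\<close> to its prime field, as the sum of the Frobenius conjugates.\<close>

definition field_trace :: "'a::{field,finite} \<Rightarrow> 'a" where
  "field_trace \<alpha> = (\<Sum>i<ext_degree TYPE('a). \<alpha> ^ (CHAR('a) ^ i))"

text \<open>The trace lies in the image of \<open>of_nat\<close>; it is read as its least non-negative residue.\<close>

definition e_p :: "'a::{field,finite} \<Rightarrow> complex" where
  "e_p \<alpha> = (let t = (THE t. t < CHAR('a) \<and> of_nat t = field_trace \<alpha>)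
            in exp (2 * of_real pi * \<i> * of_nat t / of_nat CHAR('a)))"

definition chi2 :: "'a::{field,finite} \<Rightarrow> complex" where
  "chi2 \<alpha> = (if \<alpha> = 0 then 0 else if \<exists>\<beta>. \<alpha> = \<beta>\<^sup>2 then 1 else -1)"

definition g1 :: "'a::{field,finite} itself \<Rightarrow> complex" where
  "g1 _ = (\<Sum>\<alpha>\<in>UNIV - {0::'a}. chi2 \<alpha> * e_p \<alpha>)"

definition eps_q :: "'a::{field,finite} itself \<Rightarrow> complex" where
  "eps_q T = g1 T / of_real (sqrt (real CARD('a)))"

text \<open>
  The field \<open>F\<^sub>q((x\<^sup>-\<^sup>1))\<close> is \<open>'a fls\<close>, where the series variable \<open>fls_X\<close> stands for \<open>x\<^sup>-\<^sup>1\<close>. Thus \<open>x\<close>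
  itself is \<open>fls_X_inv\<close>, and the coefficient of \<open>x\<^sup>-\<^sup>1\<close> is the one at index \<open>1\<close>.
\<close>

definition poly_to_fls_inf :: "'a::{field,finite} poly \<Rightarrow> 'a fls" where
  "poly_to_fls_inf f = poly (map_poly fls_const f) fls_X_inv"

definition e_inf :: "'a::{field,finite} fls \<Rightarrow> complex" where
  "e_inf a = e_p (fls_nth a 1)"

text \<open>The sum runs over the canonical representatives of the residue classes modulo \<open>h\<close>.\<close>

definition gauss_sum :: "'a::{field,finite} poly \<Rightarrow> 'a poly \<Rightarrow> complex" where
  "gauss_sum V h =
     cnj (eps_q TYPE('a)) ^ (degree h mod 2) *
     (\<Sum>u\<in>range (\<lambda>u. u mod h).
        psi h u * e_inf (poly_to_fls_inf (u * V) / poly_to_fls_inf h))"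

end

theory Submission
  imports Defs "HOL-Algebra.Sylow" "HOL-Analysis.Complex_Transcendental"
begin

text \<open>
  Put \<open>d = d(h)\<close>. For \<open>m < d\<close> the condition that a residue \<open>u\<close> is monic of degree \<open>m\<close> is detected by
  additive characters: with \<open>k = d - m - 1\<close>, the sum of \<open>e(u V / h) e\<^sub>p(- v\<^sub>k)\<close> over all \<open>V\<close> of degree at
  most \<open>k\<close> is \<open>q\<^bsup>k + 1\<^esup>\<close> for such \<open>u\<close> and \<open>0\<close> otherwise, because below degree \<open>d\<close> the character
  \<open>w \<mapsto> e(w / h)\<close> only sees the coefficient of \<open>w\<close> at \<open>d - 1\<close>. Summing against \<open>\<psi>\<^sub>h\<close> expresses the
  character sum through the Gauss sums of all \<open>V\<close> of degree at most \<open>k\<close>. These are grouped by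
  leading coefficient: since \<open>\<psi>\<^sub>h(c u) = \<chi>\<^sub>2(c)\<^bsup>d\<^esup> \<psi>\<^sub>h(u)\<close>, replacing \<open>V\<close> by \<open>c V\<close> multiplies the Gauss sum
  by \<open>\<chi>\<^sub>2(c)\<^bsup>d\<^esup>\<close>, and the sums over \<open>c\<close> are elementary for \<open>d\<close> even, and \<open>0\<close> or the conjugate of \<open>g\<^sub>1\<close>
  for \<open>d\<close> odd. For \<open>m \<ge> d\<close>, division by \<open>h\<close> shows that every residue is hit \<open>q\<^bsup>m - d\<^esup>\<close> times.
\<close>

subsection \<open>Finite fields, the trace and the additive character\<close>

lemma card_field_gt_1: "CARD('a::{field,finite}) > 1"
proof -
  have "card {0, 1 :: 'a} \<le> CARD('a)" by (intro card_mono) auto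
  then show ?thesis by simp
qed

lemma finite_field_char:
  shows "prime CHAR('a::{field,finite})"
  by (simp add: finite_imp_CHAR_pos prime_CHAR_semidom)

lemma card_finite_field_prime_divisor:
  assumes "prime r" "r dvd CARD('a::{field,finite})"
  shows "r = CHAR('a)"
proof -
  define G where "G = \<lparr>carrier = (UNIV :: 'a set), monoid.mult = (+), one = (0 :: 'a)\<rparr>"
  have gG: "group G"
  proof (rule groupI)
    fix x assume "x \<in> carrier G"
    show "\<exists>y\<in>carrier G. y \<otimes>\<^bsub>G\<^esub> x = \<one>\<^bsub>G\<^esub>"
      by (intro bexI[of _ "-x"]) (auto simp: G_def)
  qed (auto simp: G_def add_ac)
  from assms(2) obtain m where m: "CARD('a) = r * m" by (auto simp: dvd_def)
  have "Coset.order G = r ^ 1 * m" "finite (carrier G)"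
    using m by (auto simp: Coset.order_def G_def)
  then obtain H where H: "subgroup H G" "card H = r ^ 1"
    using sylow_thm[OF assms(1) gG] by blast
  have "card H > 1" using H(2) prime_gt_1_nat[OF assms(1)] by simp
  then have "\<not> H \<subseteq> {0}" using card_mono[of "{0}" H] by auto
  then obtain x where x: "x \<in> H" "x \<noteq> 0" by blast
  txt \<open>Translation by \<open>x\<close> permutes \<open>H\<close>, so comparing the sums of all elements gives \<open>r x = 0\<close>.\<close>
  have add: "a + b \<in> H" if "a \<in> H" "b \<in> H" for a b
    using subgroup.m_closed[OF H(1) that] by (simp add: G_def)
  have "inj_on ((+) x) H" "(+) x ` H \<subseteq> H" using x(1) add by auto
  then have "(+) x ` H = H"
    by (intro card_subset_eq) (auto simp: card_image)
  then have "sum id H = (\<Sum>y\<in>H. x + y)"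
    using sum.reindex[OF \<open>inj_on ((+) x) H\<close>, of id] by simp
  then have "of_nat r * x = 0"
    using H(2) by (simp add: sum.distrib)
  then have "CHAR('a) dvd r" using x(2) by (simp add: of_nat_eq_0_iff_char_dvd)
  then show ?thesis using assms(1) finite_field_char[where 'a='a] primes_dvd_imp_eq by blast
qed

lemma card_finite_field:
  obtains n where "n > 0" "CARD('a::{field,finite}) = CHAR('a) ^ n"
proof -
  let ?p = "CHAR('a)"
  note p = finite_field_char[where 'a='a]
  have "CARD('a) > 0" by simp
  then obtain m where m: "CARD('a) = ?p ^ multiplicity ?p CARD('a) * m" "\<not> ?p dvd m"
    using multiplicity_decompose'[of "CARD('a)" ?p] p by (metis less_numeral_extra(3) not_prime_unit)
  have "m = 1"
  proof (rule ccontr)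
    assume "m \<noteq> 1"
    then obtain r where r: "prime r" "r dvd m" by (metis prime_factor_nat)
    then have "r = ?p" using m(1) by (metis card_finite_field_prime_divisor dvd_mult)
    with r m(2) show False by simp
  qed
  then have q: "CARD('a) = ?p ^ multiplicity ?p CARD('a)" using m(1) by simp
  have "CARD('a) \<noteq> 1" using card_field_gt_1[where 'a='a] by simp
  then have "multiplicity ?p CARD('a) > 0" using q by (metis gr0I power_0)
  with q show thesis using that by blast
qed

lemma card_finite_field_ext_degree:
  "CARD('a::{field,finite}) = CHAR('a) ^ ext_degree TYPE('a)" "ext_degree TYPE('a) > 0"
proof -
  obtain n where n: "n > 0" "CARD('a) = CHAR('a) ^ n" by (rule card_finite_field)
  have "ext_degree TYPE('a) = n"
    unfolding ext_degree_def using n(2) prime_gt_1_nat[OF finite_field_char[where 'a='a]]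
    by (intro the_equality) auto
  with n show "CARD('a) = CHAR('a) ^ ext_degree TYPE('a)" "ext_degree TYPE('a) > 0" by auto
qed

lemma finite_field_power_card_minus_1:
  fixes x :: "'a::{field,finite}"
  assumes "x \<noteq> 0"
  shows "x ^ (CARD('a) - 1) = 1"
proof -
  have "(\<Prod>y\<in>UNIV-{0}. y) = (\<Prod>y\<in>UNIV-{0}. x * y)"
    by (rule prod.reindex_bij_witness[of _ "\<lambda>y. x * y" "\<lambda>y. y / x"]) (use assms in auto)
  also have "\<dots> = x ^ (CARD('a) - 1) * (\<Prod>y\<in>UNIV-{0}. y)"
    by (simp add: prod.distrib)
  finally show ?thesis by simp
qed

lemma finite_field_power_card:
  fixes x :: "'a::{field,finite}"
  shows "x ^ CARD('a) = x"
proof (cases "x = 0")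
  case False
  have "x ^ CARD('a) = x ^ Suc (CARD('a) - 1)" by simp
  then show ?thesis
    using finite_field_power_card_minus_1[OF False] by (simp only: power_Suc) simp
qed simp

lemma field_trace_add: "field_trace (x + y) = field_trace x + field_trace (y :: 'a::{field,finite})"
  unfolding field_trace_def
  by (simp add: freshmans_dream'[OF finite_field_char refl] sum.distrib)

lemma field_trace_power_char: "field_trace (x :: 'a::{field,finite}) ^ CHAR('a) = field_trace x"
proof -
  obtain k where k: "ext_degree TYPE('a) = Suc k"
    using card_finite_field_ext_degree(2)[where 'a='a] gr0_conv_Suc by blast
  have "field_trace x ^ CHAR('a) = (\<Sum>i<Suc k. x ^ (CHAR('a) ^ Suc i))"
    unfolding field_trace_def k
    by (simp only: freshmans_dream_sum[OF finite_field_char refl] power_mult[symmetric] power_Suc2)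
  also have "\<dots> = (\<Sum>i<k. x ^ (CHAR('a) ^ Suc i)) + x ^ CARD('a)"
    using k card_finite_field_ext_degree(1)[where 'a='a] by simp
  also have "\<dots> = (\<Sum>i<Suc k. x ^ (CHAR('a) ^ i))"
    by (simp only: sum.lessThan_Suc_shift finite_field_power_card) (simp add: add.commute)
  finally show ?thesis by (simp add: field_trace_def k)
qed

lemma prime_subfieldE:
  fixes x :: "'a::{field,finite}"
  assumes "x ^ CHAR('a) = x"
  obtains t where "t < CHAR('a)" "of_nat t = x"
proof -
  let ?p = "CHAR('a)"
  note p = finite_field_char[where 'a='a]
  let ?f = "monom 1 ?p - monom 1 1 :: 'a poly"
  have p1: "?p > 1" using p by (rule prime_gt_1_nat)
  then have f: "?f \<noteq> 0"
    by (metis coeff_monom less_irrefl right_minus_eq zero_neq_one)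
  have deg: "degree ?f \<le> ?p"
    using p1 by (intro degree_diff_le) (auto simp: degree_monom_eq)
  have roots: "poly ?f y = 0 \<longleftrightarrow> y ^ ?p = y" for y by (simp add: poly_monom)
  have fr: "of_nat t ^ ?p = (of_nat t :: 'a)" for t
    using p1 by (induction t) (auto simp: freshmans_dream[OF p refl] add.commute power_0_left)
  have sub: "of_nat ` {..<?p} \<subseteq> {y. poly ?f y = 0}" using fr by (auto simp only: roots)
  have "card (of_nat ` {..<?p} :: 'a set) = ?p"
    by (subst card_image) (auto intro!: inj_onI simp: of_nat_eq_iff_cong_CHAR cong_def)
  then have "of_nat ` {..<?p} = {y. poly ?f y = 0}"
    using card_poly_roots_bound[OF f] deg
    by (intro card_seteq[OF poly_roots_finite[OF f] sub]) linarith
  then have "x \<in> of_nat ` {..<?p}" using assms roots by simp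
  then show thesis using that by auto
qed

lemma field_trace_nonzero: "\<exists>x :: 'a::{field,finite}. field_trace x \<noteq> 0"
proof (rule ccontr)
  assume "\<not> ?thesis"
  then have *: "field_trace x = 0" for x :: 'a by blast
  let ?p = "CHAR('a)"
  have p1: "?p > 1" using finite_field_char by (rule prime_gt_1_nat)
  obtain k where k: "ext_degree TYPE('a) = Suc k"
    using card_finite_field_ext_degree(2)[where 'a='a] gr0_conv_Suc by blast
  let ?f = "\<Sum>i<Suc k. monom 1 (?p ^ i) :: 'a poly"
  have "coeff ?f (?p ^ 0) = (\<Sum>i<Suc k. if i = 0 then 1 else 0)"
    unfolding coeff_sum using p1 by (intro sum.cong) auto
  also have "\<dots> = 1" by simp
  finally have f: "?f \<noteq> 0" by (metis coeff_0 zero_neq_one)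
  have "degree ?f \<le> ?p ^ k"
    using p1 by (intro degree_sum_le) (auto simp: degree_monom_eq)
  moreover have "poly ?f x = field_trace x" for x
    by (simp add: field_trace_def k poly_sum poly_monom)
  with * have "{x. poly ?f x = 0} = UNIV" by simp
  ultimately have "CARD('a) \<le> ?p ^ k" using card_poly_roots_bound[OF f] by simp
  then show False using card_finite_field_ext_degree(1)[where 'a='a] k p1 by simp
qed

lemma e_p_eq:
  fixes x :: "'a::{field,finite}"
  assumes "of_nat t = field_trace x"
  shows "e_p x = exp (2 * of_real pi * \<i> * of_nat t / of_nat CHAR('a))"
proof -
  let ?p = "CHAR('a)"
  have p: "?p > 0" using finite_field_char prime_gt_0_nat by blast
  have "(THE s. s < ?p \<and> of_nat s = field_trace x) = t mod ?p"
    using p unfolding assms[symmetric]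
    by (intro the_equality) (auto simp: of_nat_eq_iff_cong_CHAR cong_def)
  then have "e_p x = exp (2 * of_real pi * \<i> * of_nat (t mod ?p) / of_nat ?p)"
    by (simp add: e_p_def)
  also have "\<dots> = exp (2 * of_real pi * \<i> * of_nat (t mod ?p) / of_nat ?p + 2 * of_nat (t div ?p) * of_real pi * \<i>)"
    using exp_integer_2pi[of "of_nat (t div ?p)"] by (simp add: exp_add)
  also have "2 * of_real pi * \<i> * of_nat (t mod ?p) / of_nat ?p + 2 * of_nat (t div ?p) * of_real pi * \<i>
      = 2 * of_real pi * \<i> * (of_nat (t mod ?p) + of_nat ?p * of_nat (t div ?p)) / of_nat ?p"
    using p by (simp add: field_simps)
  also have "of_nat (t mod ?p) + of_nat ?p * of_nat (t div ?p) = (of_nat t :: complex)"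
    by (metis mod_mult_div_eq of_nat_add of_nat_mult)
  finally show ?thesis .
qed

lemma field_trace_eq_of_nat:
  obtains t where "t < CHAR('a::{field,finite})" "of_nat t = field_trace (x :: 'a)"
  using prime_subfieldE[OF field_trace_power_char] by metis

lemma e_p_add: "e_p (x + y) = e_p x * e_p (y :: 'a::{field,finite})"
proof -
  obtain s t where st: "of_nat s = field_trace x" "of_nat t = field_trace y"
    using field_trace_eq_of_nat by metis
  then have "of_nat (s + t) = field_trace (x + y)" by (simp add: field_trace_add)
  from e_p_eq[OF this] e_p_eq[OF st(1)] e_p_eq[OF st(2)] show ?thesis
    by (simp add: exp_add[symmetric] add_divide_distrib ring_distribs)
qed

lemma e_p_nonzero [simp]: "e_p x \<noteq> 0"
  by (simp add: e_p_def Let_def)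

lemma e_p_0 [simp]: "e_p (0 :: 'a::{field,finite}) = 1"
  using e_p_add[of "0::'a" 0] by simp

lemma e_p_minus: "e_p (- x) = cnj (e_p (x :: 'a::{field,finite}))"
proof -
  have "e_p (- x) * e_p x = 1" using e_p_add[of "-x" x] by simp
  moreover have "cnj (e_p x) * e_p x = 1"
    by (simp add: e_p_def Let_def exp_cnj exp_add[symmetric] add_divide_distrib[symmetric])
  ultimately show ?thesis by (metis e_p_nonzero mult_right_cancel)
qed

lemma e_p_nontrivial: "\<exists>x :: 'a::{field,finite}. e_p x \<noteq> 1"
proof -
  obtain x :: 'a where x: "field_trace x \<noteq> 0" using field_trace_nonzero by blast
  obtain t where t: "t < CHAR('a)" "of_nat t = field_trace x" by (rule field_trace_eq_of_nat)
  with x have "t > 0" by (cases t) auto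
  have "e_p x \<noteq> 1"
  proof
    assume "e_p x = 1"
    then obtain n :: int where "2 * pi * t / CHAR('a) = of_int (2 * n) * pi"
      using e_p_eq[OF t(2)] by (auto simp: exp_eq_1)
    then have "real t = of_int n * CHAR('a)" using t(1) by (simp add: field_simps)
    then have "int t = n * int CHAR('a)" by (metis of_int_eq_iff of_int_mult of_int_of_nat_eq)
    then have "int CHAR('a) dvd int t" by simp
    with t(1) \<open>t > 0\<close> show False by (auto dest: dvd_imp_le)
  qed
  then show ?thesis by blast
qed

subsection \<open>The quadratic character of the finite field\<close>

lemma two_neq_zero_odd_card:
  assumes "odd CARD('a::{field,finite})"
  shows "(2::'a) \<noteq> 0"
proof
  assume "(2::'a) = 0"
  then have "of_nat 2 = (0::'a)" by simp
  then have "CHAR('a) dvd 2" by (simp only: of_nat_eq_0_iff_char_dvd)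
  then have "CHAR('a) = 2"
    using finite_field_char[where 'a='a] primes_dvd_imp_eq two_is_prime_nat by blast
  then show False
    using assms card_finite_field_ext_degree[where 'a='a] by simp
qed

lemma one_neq_minus_one_odd_card:
  assumes "odd CARD('a::{field,finite})"
  shows "(1::'a) \<noteq> -1"
  using two_neq_zero_odd_card[OF assms] by (metis add.inverse_inverse add_eq_0_iff one_add_one)

definition quad_sign :: "'a::{field,finite} \<Rightarrow> int" where
  "quad_sign c = (if \<exists>b. c = b\<^sup>2 then 1 else -1)"

lemma chi2_eq_quad_sign: "c \<noteq> 0 \<Longrightarrow> chi2 c = of_int (quad_sign c)"
  by (simp add: chi2_def quad_sign_def)

lemma quad_sign_square: "quad_sign c * quad_sign c = 1"
  by (simp add: quad_sign_def)

lemma card_nonzero_squares: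
  assumes "odd CARD('a::{field,finite})"
  shows "CARD('a) - 1 \<le> 2 * card ((\<lambda>b::'a. b\<^sup>2) ` (UNIV - {0}))"
proof -
  let ?S = "(\<lambda>b::'a. b\<^sup>2) ` (UNIV - {0})"
  have "CARD('a) - 1 = card (\<Union>y\<in>?S. {b. b\<^sup>2 = y} - {0})"
  proof -
    have "(\<Union>y\<in>?S. {b. b\<^sup>2 = y} - {0}) = UNIV - {0}" by auto
    then show ?thesis by simp
  qed
  also have "\<dots> \<le> (\<Sum>y\<in>?S. card ({b. b\<^sup>2 = y} - {0}))"
    by (rule card_UN_le) simp
  also have "\<dots> \<le> (\<Sum>y\<in>?S. 2)"
  proof (rule sum_mono)
    fix y assume "y \<in> ?S"
    then obtain b where "y = b\<^sup>2" by auto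
    then have "{b. b\<^sup>2 = y} - {0} \<subseteq> {b, -b}" by (auto simp: power2_eq_iff)
    then have "card ({b. b\<^sup>2 = y} - {0}) \<le> card {b, -b}" by (intro card_mono) auto
    also have "\<dots> \<le> 2" by (simp add: card_insert_if)
    finally show "card ({b. b\<^sup>2 = y} - {0}) \<le> 2" .
  qed
  finally show ?thesis by simp
qed

lemma euler_criterion_finite_field:
  fixes c :: "'a::{field,finite}"
  assumes "odd CARD('a)" "c \<noteq> 0"
  shows "c ^ ((CARD('a) - 1) div 2) = of_int (quad_sign c)"
proof -
  define N where "N = (CARD('a) - 1) div 2"
  have N: "2 * N = CARD('a) - 1" using assms(1) by (simp add: N_def)
  have N0: "N > 0" using N card_field_gt_1[where 'a='a] by simp
  let ?S = "(\<lambda>b::'a. b\<^sup>2) ` (UNIV - {0})"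
  let ?f = "monom 1 N - 1 :: 'a poly"
  have "coeff ?f N = 1" using N0 by simp
  then have f: "?f \<noteq> 0" by (metis coeff_0 zero_neq_one)
  have deg: "degree ?f \<le> N" by (intro degree_diff_le) (auto simp: degree_monom_eq)
  have roots: "poly ?f x = 0 \<longleftrightarrow> x ^ N = 1" for x by (simp add: poly_monom)
  have "(b\<^sup>2) ^ N = 1" if "b \<noteq> 0" for b :: 'a
    using finite_field_power_card_minus_1[OF that] N by (simp flip: power_mult)
  then have sub: "?S \<subseteq> {x. poly ?f x = 0}" using roots by auto
  have eq: "?S = {x. poly ?f x = 0}"
    using card_poly_roots_bound[OF f] deg card_nonzero_squares[OF assms(1)] N
    by (intro card_seteq[OF poly_roots_finite[OF f] sub]) linarith
  have sq: "(c ^ N)\<^sup>2 = 1"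
    using finite_field_power_card_minus_1[OF assms(2)] N by (simp flip: power_mult add: mult.commute)
  have "c \<in> ?S \<longleftrightarrow> (\<exists>b. c = b\<^sup>2)" using assms(2) by auto
  then have "c ^ N = 1 \<longleftrightarrow> (\<exists>b. c = b\<^sup>2)" using eq roots by simp
  moreover have "c ^ N = 1 \<or> c ^ N = -1" using sq by (simp add: power2_eq_1_iff)
  ultimately show ?thesis unfolding N_def[symmetric] quad_sign_def by auto
qed

lemma quad_sign_mult:
  fixes c d :: "'a::{field,finite}"
  assumes "odd CARD('a)" "c \<noteq> 0" "d \<noteq> 0"
  shows "quad_sign (c * d) = quad_sign c * quad_sign d"
proof -
  have "(1::'a) \<noteq> -1" using assms(1) by (rule one_neq_minus_one_odd_card)
  moreover have "of_int (quad_sign (c * d)) = (of_int (quad_sign c * quad_sign d) :: 'a)"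
    using assms by (simp add: euler_criterion_finite_field[symmetric] power_mult_distrib)
  ultimately show ?thesis by (auto simp: quad_sign_def split: if_splits)
qed

lemma quad_sign_minus_1_exists:
  assumes "odd CARD('a::{field,finite})"
  shows "\<exists>c::'a. c \<noteq> 0 \<and> quad_sign c = -1"
proof -
  have "(1::'a) \<noteq> -1" using assms(1) by (rule one_neq_minus_one_odd_card)
  then have "\<not> inj (\<lambda>b::'a. b\<^sup>2)" by (metis injD power2_minus)
  then have "\<not> surj (\<lambda>b::'a. b\<^sup>2)" by (metis finite_UNIV_surj_inj finite)
  then obtain c :: 'a where "\<forall>b. c \<noteq> b\<^sup>2" by (auto simp: surj_def)
  then show ?thesis by (intro exI[of _ c]) (force simp: quad_sign_def)
qed

lemma power_half_card_power:
  fixes c :: "'a::{field,finite}"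
  assumes "odd CARD('a)" "c \<noteq> 0"
  shows "c ^ ((CARD('a) ^ k - 1) div 2) = of_int (quad_sign c ^ k)"
proof (induction k)
  case (Suc k)
  let ?q = "CARD('a)"
  have "odd (?q ^ k)" using assms(1) by simp
  then obtain a where a: "?q ^ k = 2 * a + 1" by (rule oddE)
  obtain b where b: "?q = 2 * b + 1" using assms(1) by (rule oddE)
  have "(?q ^ Suc k - 1) div 2 = a * ?q + b" using a b by (simp add: algebra_simps)
  then have "c ^ ((?q ^ Suc k - 1) div 2) = (c ^ a) ^ ?q * c ^ b"
    by (simp only: power_add power_mult)
  also have "\<dots> = c ^ a * c ^ b" by (simp only: finite_field_power_card)
  also have "\<dots> = c ^ ((?q ^ k - 1) div 2) * c ^ ((?q - 1) div 2)"
    using a b by simp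
  finally show ?case
    using Suc euler_criterion_finite_field[OF assms] by (simp add: mult.commute)
qed simp

subsection \<open>Polynomials of bounded degree\<close>

definition polys_below :: "nat \<Rightarrow> 'a::zero poly set" where
  "polys_below n = {f. \<forall>i\<ge>n. coeff f i = 0}"

lemma polys_below_0 [simp]: "polys_below 0 = {0}"
  by (auto simp: polys_below_def poly_eq_iff)

lemma polys_below_Suc: "polys_below (Suc n) = case_prod pCons ` (UNIV \<times> polys_below n)"
proof (intro Set.set_eqI iffI)
  fix f :: "'a poly" assume f: "f \<in> polys_below (Suc n)"
  obtain a g where "f = pCons a g" by (cases f)
  with f show "f \<in> case_prod pCons ` (UNIV \<times> polys_below n)"
    by (fastforce simp: polys_below_def image_iff)
qed (auto simp: polys_below_def coeff_pCons split: nat.splits)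

lemma finite_polys_below [simp]: "finite (polys_below n :: 'a::{zero,finite} poly set)"
  by (induction n) (simp_all add: polys_below_Suc)

lemma card_polys_below: "card (polys_below n :: 'a::{zero,finite} poly set) = CARD('a) ^ n"
proof (induction n)
  case (Suc n)
  have "inj_on (case_prod pCons) (UNIV \<times> polys_below n :: ('a \<times> 'a poly) set)"
    by (auto intro!: inj_onI)
  then show ?case
    using Suc by (simp add: polys_below_Suc card_image card_cartesian_product)
qed simp

lemma polys_below_add:
  fixes f g :: "'a::comm_monoid_add poly"
  shows "f \<in> polys_below n \<Longrightarrow> g \<in> polys_below n \<Longrightarrow> f + g \<in> polys_below n"
  by (simp add: polys_below_def)

lemma polys_below_diff:
  fixes f g :: "'a::ab_group_add poly"
  shows "f \<in> polys_below n \<Longrightarrow> g \<in> polys_below n \<Longrightarrow> f - g \<in> polys_below n"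
  by (simp add: polys_below_def)

lemma polys_below_smult:
  fixes f g :: "'a::comm_semiring_0 poly"
  shows "f \<in> polys_below n \<Longrightarrow> smult c f \<in> polys_below n"
  by (simp add: polys_below_def)

lemma zero_in_polys_below [simp]: "0 \<in> polys_below n"
  by (simp add: polys_below_def)

lemma polys_below_iff: "f \<in> polys_below n \<longleftrightarrow> f = 0 \<or> degree f < n"
proof
  assume f: "f \<in> polys_below n"
  show "f = 0 \<or> degree f < n"
  proof (rule ccontr)
    assume *: "\<not> ?thesis"
    then have "coeff f (degree f) = 0" using f by (simp add: polys_below_def)
    with * show False by simp
  qed
qed (auto simp: polys_below_def coeff_eq_0)

lemma range_mod_eq_polys_below:
  fixes h :: "'a::field poly"
  assumes "h \<noteq> 0"
  shows "range (\<lambda>u. u mod h) = polys_below (degree h)"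
proof (intro Set.set_eqI iffI)
  fix f :: "'a poly" assume "f \<in> polys_below (degree h)"
  then have "f mod h = f" by (auto simp: polys_below_iff mod_poly_less)
  then show "f \<in> range (\<lambda>u. u mod h)" by (metis rangeI)
qed (use degree_mod_less'[OF assms] in \<open>auto simp: polys_below_iff\<close>)

lemma mod_in_polys_below:
  fixes h :: "'a::field poly"
  shows "h \<noteq> 0 \<Longrightarrow> u mod h \<in> polys_below (degree h)"
  using range_mod_eq_polys_below by blast

subsection \<open>The Jacobi symbol\<close>

lemma fermat_poly:
  fixes a P :: "'a::{field,finite} poly"
  assumes "irreducible P" "\<not> P dvd a"
  shows "[a ^ (pabs P - 1) = 1] (mod P)"
proof -
  have P: "prime_elem P" using assms(1) by (rule field_poly_irreducible_imp_prime)
  then have P0: "P \<noteq> 0" by auto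
  let ?R = "polys_below (degree P) - {0} :: 'a poly set"
  have nd: "\<not> P dvd r" if "r \<in> ?R" for r
    using that by (auto simp: polys_below_iff dest: dvd_imp_degree_le)
  have inj: "inj_on (\<lambda>r. a * r mod P) ?R"
  proof (rule inj_onI)
    fix r s assume rs: "r \<in> ?R" "s \<in> ?R" "a * r mod P = a * s mod P"
    then have "P dvd a * (r - s)" by (simp add: mod_eq_dvd_iff right_diff_distrib)
    then have "P dvd r - s" using P assms(2) by (simp add: prime_elem_dvd_mult_iff)
    moreover have "r - s \<in> polys_below (degree P)" using rs by (simp add: polys_below_diff)
    ultimately have "r - s = 0" using nd by blast
    then show "r = s" by simp
  qed
  have "(\<lambda>r. a * r mod P) ` ?R \<subseteq> ?R"
    using nd P assms(2) P0 by (auto simp: mod_in_polys_below mod_eq_0_iff_dvd prime_elem_dvd_mult_iff)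
  then have im: "(\<lambda>r. a * r mod P) ` ?R = ?R"
    using inj by (intro card_subset_eq) (auto simp: card_image)
  have "[(\<Prod>r\<in>?R. a * r) = (\<Prod>r\<in>?R. a * r mod P)] (mod P)"
    by (rule cong_prod) simp
  also have "(\<Prod>r\<in>?R. a * r mod P) = \<Prod>?R"
    using prod.reindex[OF inj, of id] im by simp
  finally have "[a ^ (pabs P - 1) * \<Prod>?R = \<Prod>?R] (mod P)"
    by (simp add: prod.distrib card_polys_below pabs_def)
  then have "P dvd (a ^ (pabs P - 1) - 1) * \<Prod>?R"
    by (simp add: cong_iff_dvd_diff left_diff_distrib)
  moreover have "\<not> P dvd \<Prod>?R"
  proof -
    have "\<not> P dvd \<Prod>A" if "finite A" "A \<subseteq> ?R" for A
      using that
    proof (induction A)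
      case empty
      then show ?case using P by auto
    next
      case (insert r A)
      then show ?case using P nd by (simp add: prime_elem_dvd_mult_iff)
    qed
    then show ?thesis by simp
  qed
  ultimately show ?thesis
    using P by (simp add: cong_iff_dvd_diff prime_elem_dvd_mult_iff)
qed

lemma irreducible_degree_pos:
  fixes P :: "'a::field poly"
  shows "irreducible P \<Longrightarrow> degree P > 0"
  by (metis gr0I irreducible_def is_unit_iff_degree)

lemma pabs_odd: "odd CARD('a::{field,finite}) \<Longrightarrow> odd (pabs (P :: 'a poly))"
  by (simp add: pabs_def)

lemma legendre_symbol_ex:
  fixes a P :: "'a::{field,finite} poly"
  assumes "odd CARD('a)" "irreducible P"
  shows "\<exists>s\<in>{-1, 0, 1}. [a ^ ((pabs P - 1) div 2) = of_int s] (mod P)"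
proof -
  define N where "N = (pabs P - 1) div 2"
  have N: "pabs P - 1 = N * 2" using pabs_odd[OF assms(1), of P] by (simp add: N_def)
  have P: "prime_elem P" using assms(2) by (rule field_poly_irreducible_imp_prime)
  show ?thesis
  proof (cases "P dvd a")
    case True
    have "CARD('a) > 1" by (rule card_field_gt_1)
    then have "pabs P > 1"
      unfolding pabs_def by (intro one_less_power irreducible_degree_pos assms(2))
    then have "N > 0" using N by (cases N) auto
    then have "P dvd a ^ N" using True by (meson dvd_power dvd_trans)
    then show ?thesis by (auto simp: N_def cong_0_iff)
  next
    case False
    have "P dvd a ^ (pabs P - 1) - 1" using fermat_poly[OF assms(2) False] by (simp add: cong_iff_dvd_diff)
    also have "a ^ (pabs P - 1) - 1 = (a ^ N - 1) * (a ^ N + 1)"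
      unfolding N by (simp add: power_mult power2_eq_square algebra_simps)
    finally have "P dvd a ^ N - 1 \<or> P dvd a ^ N + 1" using P by (simp add: prime_elem_dvd_mult_iff)
    then show ?thesis by (auto simp: N_def cong_iff_dvd_diff)
  qed
qed

lemma legendre_symbol_eqI:
  fixes a P :: "'a::{field,finite} poly"
  assumes "odd CARD('a)" "irreducible P" "s \<in> {-1, 0, 1}"
    and "[a ^ ((pabs P - 1) div 2) = of_int s] (mod P)"
  shows "legendre_symbol a P = s"
  unfolding legendre_symbol_def
proof (rule the_equality)
  fix t assume t: "t \<in> {-1, 0, 1} \<and> [a ^ ((pabs P - 1) div 2) = of_int t] (mod P)"
  with assms(4) have "[of_int s = (of_int t :: 'a poly)] (mod P)"
    by (metis cong_sym cong_trans)
  then have "P dvd of_int (s - t)" by (simp add: cong_iff_dvd_diff)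
  then have "P dvd [:of_int (s - t):]" by (simp only: of_int_poly)
  then have "(of_int (s - t) :: 'a) = 0"
    using irreducible_degree_pos[OF assms(2)] dvd_imp_degree_le[of P "[:of_int (s - t):]"]
    by (cases "of_int (s - t) = (0 :: 'a)") auto
  moreover have "s - t \<in> {-2, -1, 0, 1, 2}" using t assms(3) by auto
  ultimately have "s - t = 0" using two_neq_zero_odd_card[OF assms(1)] by (auto simp del: of_int_diff)
  then show "t = s" by simp
qed (use assms in auto)

lemma legendre_symbol_smult:
  fixes a P :: "'a::{field,finite} poly"
  assumes "odd CARD('a)" "irreducible P" "c \<noteq> 0"
  shows "legendre_symbol (smult c a) P = quad_sign c ^ degree P * legendre_symbol a P"
proof -
  obtain s where s: "s \<in> {-1, 0, 1}" "[a ^ ((pabs P - 1) div 2) = of_int s] (mod P)"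
    using legendre_symbol_ex[OF assms(1,2)] by blast
  let ?e = "quad_sign c ^ degree P"
  have "(smult c a) ^ ((pabs P - 1) div 2) = of_int ?e * a ^ ((pabs P - 1) div 2)"
    using power_half_card_power[OF assms(1,3), of "degree P"]
    by (simp add: smult_power of_int_poly pabs_def)
  also have "[\<dots> = of_int ?e * of_int s] (mod P)" using s(2) by (rule cong_scalar_left)
  also have "of_int ?e * of_int s = (of_int (?e * s) :: 'a poly)" by simp
  finally have "[(smult c a) ^ ((pabs P - 1) div 2) = of_int (?e * s)] (mod P)" .
  moreover have "?e = 1 \<or> ?e = -1" by (simp add: quad_sign_def minus_one_power_iff)
  then have "?e * s \<in> {-1, 0, 1}" using s(1) by auto
  ultimately have "legendre_symbol (smult c a) P = ?e * s"
    by (intro legendre_symbol_eqI assms)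
  moreover have "legendre_symbol a P = s" using s by (intro legendre_symbol_eqI assms)
  ultimately show ?thesis by simp
qed

lemma legendre_symbol_cong:
  assumes "[a = b] (mod P)"
  shows "legendre_symbol a P = legendre_symbol b P"
proof -
  have "[a ^ n = s] (mod P) \<longleftrightarrow> [b ^ n = s] (mod P)" for n s
    using cong_pow[OF assms, of n] by (metis cong_sym cong_trans)
  then show ?thesis by (simp add: legendre_symbol_def)
qed

lemma psi_cong:
  assumes "[a = b] (mod f)"
  shows "psi f a = psi f b"
proof -
  have "legendre_symbol a P = legendre_symbol b P" if "P dvd f" for P
    using assms that by (intro legendre_symbol_cong) (rule cong_dvd_modulus)
  then show ?thesis by (simp add: psi_def jacobi_symbol_def)
qed

lemma power_dvd_imp_le_degree:
  fixes f P :: "'a::field poly"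
  assumes "f \<noteq> 0" "degree P > 0" "P ^ n dvd f"
  shows "n \<le> degree f"
proof -
  have "n \<le> n * degree P" using assms(2) by simp
  also have "\<dots> = degree (P ^ n)" using assms(2) by (metis degree_0 degree_power_eq less_irrefl)
  also have "\<dots> \<le> degree f" using assms by (intro dvd_imp_degree_le)
  finally show ?thesis .
qed

lemma power_dvd_iff_le_poly_multiplicity:
  fixes f P :: "'a::{field,finite} poly"
  assumes "f \<noteq> 0" "degree P > 0"
  shows "P ^ n dvd f \<longleftrightarrow> n \<le> poly_multiplicity P f"
proof -
  have "{n. P ^ n dvd f} \<subseteq> {..degree f}"
    using power_dvd_imp_le_degree[OF assms] by auto
  then have fin: "finite {n. P ^ n dvd f}" by (rule finite_subset) simp
  have "0 \<in> {n. P ^ n dvd f}" by simp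
  then have "poly_multiplicity P f \<in> {n. P ^ n dvd f}"
    unfolding poly_multiplicity_def using fin by (intro Max_in) blast+
  then have "P ^ poly_multiplicity P f dvd f" by simp
  then have "n \<le> poly_multiplicity P f \<Longrightarrow> P ^ n dvd f"
    by (meson dvd_trans le_imp_power_dvd)
  then show ?thesis
    using fin by (auto simp: poly_multiplicity_def intro: Max_ge)
qed

lemma poly_multiplicity_eqI:
  fixes f P :: "'a::{field,finite} poly"
  assumes "f \<noteq> 0" "degree P > 0" "\<And>n. P ^ n dvd f \<longleftrightarrow> n \<le> k"
  shows "poly_multiplicity P f = k"
  using power_dvd_iff_le_poly_multiplicity[OF assms(1,2)] assms(3) by (metis order.antisym order.refl)

lemma monic_irreducible_dvd_imp_eq:
  fixes P Q :: "'a::{field,finite} poly"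
  assumes "monic P" "irreducible P" "monic Q" "irreducible Q" "Q dvd P"
  shows "P = Q"
proof -
  obtain u where u: "P = Q * u" using assms(5) by (rule dvdE)
  then have "u dvd 1"
    using irreducibleD[OF assms(2) u] assms(4) irreducible_not_unit by blast
  then obtain c where "u = [:c:]" by (auto simp: is_unit_poly_iff)
  with u assms(1,3) show ?thesis by (cases "c = 0") auto
qed

lemma poly_multiplicity_mult_irreducible:
  fixes P Q g :: "'a::{field,finite} poly"
  assumes "monic P" "irreducible P" "monic Q" "irreducible Q" "g \<noteq> 0"
  shows "poly_multiplicity Q (P * g) = poly_multiplicity Q g + (if Q = P then 1 else 0)"
proof (rule poly_multiplicity_eqI)
  have P0: "P \<noteq> 0" using assms(2) by auto
  then show "P * g \<noteq> 0" using assms(5) by simp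
  show dQ: "degree Q > 0" using assms(4) by (rule irreducible_degree_pos)
  fix n
  note g = power_dvd_iff_le_poly_multiplicity[OF assms(5) dQ]
  show "Q ^ n dvd P * g \<longleftrightarrow> n \<le> poly_multiplicity Q g + (if Q = P then 1 else 0)"
  proof (cases "Q = P")
    case True
    then show ?thesis using g P0 by (cases n) auto
  next
    case False
    have pQ: "prime_elem Q" using assms(4) by (rule field_poly_irreducible_imp_prime)
    have "\<not> Q dvd P" using False monic_irreducible_dvd_imp_eq assms(1-4) by blast
    then have "Q ^ n dvd P * g \<longleftrightarrow> Q ^ n dvd g"
      using prime_power_dvd_multD[OF pQ, of n P g] by (cases "n = 0") auto
    with False g show ?thesis by simp
  qed
qed

lemma monic_irreducible_factor_exists:
  fixes f :: "'a::{field,finite} poly"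
  assumes "degree f > 0"
  shows "\<exists>P. monic P \<and> irreducible P \<and> P dvd f"
proof -
  obtain P where P: "P dvd f" "degree P > 0"
    and min: "\<And>Q. Q dvd f \<Longrightarrow> degree Q > 0 \<Longrightarrow> degree P \<le> degree Q"
    using ex_has_least_nat[of "\<lambda>P. P dvd f \<and> degree P > 0" f degree] assms by auto
  have P0: "P \<noteq> 0" using P(2) by auto
  have "irreducible P"
  proof (rule irreducibleI)
    show "\<not> P dvd 1" using P P0 by (simp add: is_unit_iff_degree)
    fix a b assume ab: "P = a * b"
    then have nz: "a \<noteq> 0" "b \<noteq> 0" using P0 by auto
    then have deg: "degree P = degree a + degree b" using ab by (simp add: degree_mult_eq)
    show "a dvd 1 \<or> b dvd 1"
    proof (rule ccontr)
      assume "\<not> ?thesis"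
      then have "degree a > 0" "degree b > 0" using nz by (auto simp: is_unit_iff_degree)
      moreover have "a dvd f" using ab P(1) by (metis dvd_mult_left)
      ultimately show False using min[of a] deg by simp
    qed
  qed (use P0 in auto)
  let ?c = "inverse (lead_coeff P)"
  have "?c \<noteq> 0" using P0 by simp
  have "irreducible (smult ?c P)"
  proof -
    have "smult ?c P = [:?c:] * P" by simp
    moreover have "[:?c:] dvd 1" using P0 by (simp add: is_unit_iff_degree)
    ultimately show ?thesis using \<open>irreducible P\<close> by (metis irreducible_mult_unit_left)
  qed
  moreover have "monic (smult ?c P)" using P0 by simp
  moreover have "smult ?c P dvd f" using P(1) P0 by (simp add: smult_dvd_iff)
  ultimately show ?thesis by blast
qed

lemma finite_monic_irreducible_divisors:
  fixes f :: "'a::{field,finite} poly"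
  assumes "f \<noteq> 0"
  shows "finite {P. monic P \<and> irreducible P \<and> P dvd f}"
proof (rule finite_subset[OF _ finite_polys_below])
  show "{P. monic P \<and> irreducible P \<and> P dvd f} \<subseteq> polys_below (Suc (degree f))"
    using assms by (auto simp: polys_below_iff less_Suc_eq_le dvd_imp_degree_le)
qed

lemma sum_degree_poly_multiplicity:
  fixes f :: "'a::{field,finite} poly"
  assumes "f \<noteq> 0"
  shows "(\<Sum>P | monic P \<and> irreducible P \<and> P dvd f. degree P * poly_multiplicity P f) = degree f"
  using assms
proof (induction "degree f" arbitrary: f rule: less_induct)
  case less
  let ?S = "\<lambda>f. {P. monic P \<and> irreducible P \<and> P dvd f}"
  show ?case
  proof (cases "degree f = 0")
    case True
    then have S: "?S f = {}"
      using less.prems irreducible_degree_pos dvd_imp_degree_le[of _ f] by fastforce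
    show ?thesis using True by (subst S) simp
  next
    case False
    then obtain P where P: "monic P" "irreducible P" "P dvd f"
      using monic_irreducible_factor_exists by blast
    then obtain g where f: "f = P * g" by (elim dvdE)
    have g0: "g \<noteq> 0" and P0: "P \<noteq> 0" using f less.prems by auto
    have deg: "degree f = degree P + degree g" using f g0 P0 by (simp add: degree_mult_eq)
    have IH: "(\<Sum>Q\<in>?S g. degree Q * poly_multiplicity Q g) = degree g"
      using deg irreducible_degree_pos[OF P(2)] g0 by (intro less.hyps) auto
    have fin: "finite (?S f)" using less.prems by (rule finite_monic_irreducible_divisors)
    have mult0: "poly_multiplicity Q g = 0" if "Q \<in> ?S f - ?S g" for Q
    proof (rule poly_multiplicity_eqI[OF g0])
      show "degree Q > 0" using that irreducible_degree_pos by auto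
      fix n show "Q ^ n dvd g \<longleftrightarrow> n \<le> 0"
        using that by (cases n) (auto dest: dvd_mult_left)
    qed
    have "(\<Sum>Q\<in>?S f. degree Q * poly_multiplicity Q f)
        = (\<Sum>Q\<in>?S f. degree Q * poly_multiplicity Q g + (if Q = P then degree Q else 0))"
      using P g0 unfolding f by (intro sum.cong refl) (simp add: poly_multiplicity_mult_irreducible)
    also have "\<dots> = (\<Sum>Q\<in>?S f. degree Q * poly_multiplicity Q g) + degree P"
      using fin P by (simp add: sum.distrib)
    also have "(\<Sum>Q\<in>?S f. degree Q * poly_multiplicity Q g) = (\<Sum>Q\<in>?S g. degree Q * poly_multiplicity Q g)"
      using fin mult0 by (intro sum.mono_neutral_right) (auto simp: f)
    finally show ?thesis using IH deg by simp
  qed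
qed

lemma psi_smult:
  fixes a f :: "'a::{field,finite} poly"
  assumes "odd CARD('a)" "f \<noteq> 0" "c \<noteq> 0"
  shows "psi f (smult c a) = of_int (quad_sign c) ^ degree f * psi f a"
proof -
  let ?S = "{P. monic P \<and> irreducible P \<and> P dvd f}"
  have "jacobi_symbol (smult c a) f
      = (\<Prod>P\<in>?S. (quad_sign c ^ degree P * legendre_symbol a P) ^ poly_multiplicity P f)"
    using assms unfolding jacobi_symbol_def
    by (intro prod.cong refl) (simp add: legendre_symbol_smult)
  also have "\<dots> = quad_sign c ^ (\<Sum>P\<in>?S. degree P * poly_multiplicity P f) * jacobi_symbol a f"
    by (simp add: power_mult_distrib prod.distrib power_sum jacobi_symbol_def flip: power_mult)
  finally show ?thesis
    using sum_degree_poly_multiplicity[OF assms(2)] by (simp add: psi_def)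
qed

subsection \<open>Laurent expansions of quotients\<close>

lemma fls_nth_poly_to_fls_inf:
  "fls_nth (poly_to_fls_inf f) n = (if n \<le> 0 then coeff f (nat (-n)) else 0)"
proof (induction f arbitrary: n)
  case (pCons a f)
  have "poly_to_fls_inf (pCons a f) = fls_const a + fls_X_inv * poly_to_fls_inf f"
    by (simp add: poly_to_fls_inf_def map_poly_pCons)
  then have "fls_nth (poly_to_fls_inf (pCons a f)) n
      = (if n = 0 then a else 0) + fls_nth (poly_to_fls_inf f) (n + 1)"
    by (simp add: fls_X_inv_times_conv_shift)
  also have "\<dots> = (if n \<le> 0 then coeff (pCons a f) (nat (-n)) else 0)"
  proof (cases "n < 0")
    case True
    then have "nat (-n) = Suc (nat (-(n + 1)))" by simp
    with True pCons.IH[of "n + 1"] show ?thesis by simp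
  qed (use pCons.IH[of "n + 1"] in auto)
  finally show ?case .
qed (simp add: poly_to_fls_inf_def)

lemma poly_to_fls_inf_add: "poly_to_fls_inf (f + g) = poly_to_fls_inf f + poly_to_fls_inf g"
  by (rule fls_eqI) (simp add: fls_nth_poly_to_fls_inf)

lemma poly_to_fls_inf_eq_0_iff [simp]: "poly_to_fls_inf f = 0 \<longleftrightarrow> f = 0"
proof
  assume "poly_to_fls_inf f = 0"
  then have "coeff f i = 0" for i
    using fls_nth_poly_to_fls_inf[of f "- int i"] by simp
  then show "f = 0" by (simp add: poly_eq_iff)
qed (auto intro: fls_eqI simp: fls_nth_poly_to_fls_inf)

lemma poly_to_fls_inf_0 [simp]: "poly_to_fls_inf 0 = 0"
  by simp

lemma fls_subdegree_poly_to_fls_inf: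
  "f \<noteq> 0 \<Longrightarrow> fls_subdegree (poly_to_fls_inf f) = - int (degree f)"
  by (rule fls_subdegree_eqI) (auto simp: fls_nth_poly_to_fls_inf coeff_eq_0)

lemma fls_nth_poly_quotient:
  fixes w h :: "'a::{field,finite} poly"
  assumes "monic h" "w \<in> polys_below (degree h)"
  shows "fls_nth (poly_to_fls_inf w / poly_to_fls_inf h) 1 = coeff w (degree h - 1)"
proof (cases "w = 0")
  case False
  let ?d = "degree h" and ?W = "poly_to_fls_inf w" and ?H = "poly_to_fls_inf h"
  have h0: "h \<noteq> 0" using assms(1) by auto
  have dw: "degree w < ?d" using assms(2) False by (simp add: polys_below_iff)
  let ?Q = "?W / ?H"
  have Q: "?Q * ?H = ?W" using h0 by simp
  have sub: "fls_subdegree ?Q = int ?d - int (degree w)"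
    using False h0 by (simp add: fls_divide_subdegree fls_subdegree_poly_to_fls_inf)
  show ?thesis
  proof (cases "degree w = ?d - 1")
    case True
    then have s: "fls_subdegree ?Q = 1" using sub dw by simp
    have "fls_nth ?Q 1 * fls_nth ?H (- int ?d) = fls_nth ?W (1 - int ?d)"
      using fls_times_base[of ?Q ?H] h0 s Q by (simp add: fls_subdegree_poly_to_fls_inf)
    then show ?thesis using assms(1) dw by (simp add: fls_nth_poly_to_fls_inf nat_diff_distrib)
  next
    case False
    then have "fls_subdegree ?Q > 1" using sub dw by simp
    moreover have "coeff w (?d - 1) = 0" using False dw by (intro coeff_eq_0) simp
    ultimately show ?thesis by simp
  qed
qed simp

subsection \<open>Character sums over the finite field\<close>

lemma sum_character_eq_0:
  fixes F :: "'a::ab_group_add \<Rightarrow> 'b::field"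
  assumes "\<And>x. x \<in> A \<Longrightarrow> x + v \<in> A" "\<And>x. x \<in> A \<Longrightarrow> x - v \<in> A"
    and "\<And>x. x \<in> A \<Longrightarrow> F (x + v) = c * F x" "c \<noteq> 1"
  shows "sum F A = 0"
proof -
  have "sum F A = (\<Sum>x\<in>A. F (x + v))"
    by (rule sum.reindex_bij_witness[of _ "\<lambda>x. x + v" "\<lambda>x. x - v"]) (use assms(1,2) in auto)
  also have "\<dots> = c * sum F A" using assms(3) by (simp add: sum_distrib_left)
  finally show ?thesis using assms(4) by simp
qed

lemma e_p_mult_nontrivial:
  fixes a :: "'a::{field,finite}"
  assumes "a \<noteq> 0"
  shows "\<exists>c. e_p (c * a) \<noteq> 1"
proof -
  obtain x :: 'a where "e_p x \<noteq> 1" using e_p_nontrivial by blast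
  then show ?thesis using assms by (intro exI[of _ "x / a"]) simp
qed

lemma sum_e_p_nonzero: "(\<Sum>c\<in>UNIV - {0::'a::{field,finite}}. e_p (- c)) = -1"
proof -
  obtain x :: 'a where x: "e_p x \<noteq> 1" using e_p_nontrivial by blast
  have "(\<Sum>c\<in>(UNIV :: 'a set). e_p (- c)) = 0"
    using x by (intro sum_character_eq_0[where v = "- x" and c = "e_p x"]) (auto simp: e_p_add[symmetric] algebra_simps)
  then show ?thesis by (simp add: sum_diff1)
qed

lemma sum_quad_sign:
  assumes "odd CARD('a::{field,finite})"
  shows "(\<Sum>c\<in>UNIV - {0::'a}. of_int (quad_sign c) :: complex) = 0"
proof -
  obtain e :: 'a where e: "e \<noteq> 0" "quad_sign e = -1"
    using quad_sign_minus_1_exists[OF assms] by blast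
  have "(\<Sum>c\<in>UNIV - {0::'a}. of_int (quad_sign c) :: complex)
      = (\<Sum>c\<in>UNIV - {0::'a}. of_int (quad_sign (e * c)))"
    by (rule sum.reindex_bij_witness[of _ "\<lambda>c. e * c" "\<lambda>c. c / e"]) (use e in auto)
  also have "\<dots> = (\<Sum>c\<in>UNIV - {0::'a}. - of_int (quad_sign c))"
    using e by (intro sum.cong refl) (simp add: quad_sign_mult[OF assms])
  finally show ?thesis by (simp add: sum_negf)
qed

lemma sum_quad_sign_e_p_minus:
  "(\<Sum>c\<in>UNIV - {0::'a::{field,finite}}. of_int (quad_sign c) * e_p (- c))
     = of_real (sqrt (real CARD('a))) * cnj (eps_q TYPE('a))"
proof -
  have "(\<Sum>c\<in>UNIV - {0::'a}. of_int (quad_sign c) * e_p (- c)) = cnj (g1 TYPE('a))"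
    by (simp add: g1_def cnj_sum e_p_minus chi2_eq_quad_sign)
  then show ?thesis by (simp add: eps_q_def)
qed

subsection \<open>Orthogonality and Gauss sums\<close>

definition poly_char :: "'a::{field,finite} poly \<Rightarrow> 'a poly \<Rightarrow> complex" where
  "poly_char h w = e_inf (poly_to_fls_inf w / poly_to_fls_inf h)"

lemma poly_char_add: "poly_char h (v + w) = poly_char h v * poly_char h w"
  by (simp add: poly_char_def e_inf_def poly_to_fls_inf_add add_divide_distrib e_p_add)

lemma poly_char_0 [simp]: "poly_char h 0 = 1"
  by (simp add: poly_char_def e_inf_def)

lemma poly_char_eq:
  "monic h \<Longrightarrow> w \<in> polys_below (degree h) \<Longrightarrow> poly_char h w = e_p (coeff w (degree h - 1))"
  by (simp add: poly_char_def e_inf_def fls_nth_poly_quotient)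

lemma monics_deg_eq: "monics_deg (int m) = {f \<in> polys_below (Suc m). coeff f m = 1}"
proof (intro Set.set_eqI iffI)
  fix f :: "'a poly" assume f: "f \<in> {f \<in> polys_below (Suc m). coeff f m = 1}"
  then have "f \<noteq> 0" by auto
  with f have "degree f \<le> m" by (simp add: polys_below_iff)
  moreover have "m \<le> degree f" using f by (intro le_degree) simp
  ultimately show "f \<in> monics_deg (int m)" using f by (auto simp: monics_deg_def)
qed (auto simp: monics_deg_def polys_below_iff)

lemma orthogonality_monics_deg:
  fixes h u :: "'a::{field,finite} poly"
  assumes "monic h" "m < degree h" "u \<in> polys_below (degree h)"
  shows "(\<Sum>V\<in>polys_below (degree h - m). poly_char h (u * V) * e_p (- coeff V (degree h - m - 1)))
       = (if u \<in> monics_deg (int m) then of_nat (CARD('a) ^ (degree h - m)) else 0)"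
proof -
  let ?d = "degree h"
  define k where "k = ?d - m - 1"
  have k: "?d - m = Suc k" "?d - 1 = m + k" using assms(2) by (auto simp: k_def)
  define F where "F = (\<lambda>V. poly_char h (u * V) * e_p (- coeff V k))"
  have F_add: "F (V + W) = F W * F V" for V W
    using e_p_add[of "- coeff V k" "- coeff W k"] by (simp add: F_def distrib_left poly_char_add)
  have coeff_top: "coeff (u * V) (m + k) = coeff u m * coeff V k"
    and below: "u * V \<in> polys_below ?d"
    if "u \<in> polys_below (Suc m)" "V \<in> polys_below (Suc k)" for V
  proof -
    have dV: "degree V \<le> k" and du: "degree u \<le> m" using that by (auto simp: polys_below_iff)
    show "coeff (u * V) (m + k) = coeff u m * coeff V k"
    proof (cases "degree u = m \<and> degree V = k")
      case True
      then show ?thesis by (auto simp: coeff_mult_degree_sum)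
    next
      case False
      with du dV have "degree u + degree V < m + k" by linarith
      then have "coeff (u * V) (m + k) = 0" by (intro coeff_eq_0 le_less_trans[OF degree_mult_le])
      moreover have "degree u < m \<or> degree V < k" using False du dV by linarith
      then have "coeff u m * coeff V k = 0" by (auto simp: coeff_eq_0)
      ultimately show ?thesis by simp
    qed
    have "degree (u * V) < ?d"
      using du dV k assms(2) by (intro le_less_trans[OF degree_mult_le]) simp
    then show "u * V \<in> polys_below ?d" by (simp add: polys_below_iff)
  qed
  have F_low: "F V = e_p ((coeff u m - 1) * coeff V k)"
    if "u \<in> polys_below (Suc m)" "V \<in> polys_below (Suc k)" for V
  proof -
    have "poly_char h (u * V) = e_p (coeff u m * coeff V k)"
      using poly_char_eq[OF assms(1) below[OF that]] unfolding k coeff_top[OF that] .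
    then show ?thesis by (simp add: F_def e_p_add[symmetric] algebra_simps)
  qed
  have "sum F (polys_below (Suc k)) = (if u \<in> monics_deg (int m) then of_nat (CARD('a) ^ Suc k) else 0)"
  proof (cases "u \<in> monics_deg (int m)")
    case True
    then have "F V = 1" if "V \<in> polys_below (Suc k)" for V
      using F_low[OF _ that] by (simp add: monics_deg_eq)
    then have "sum F (polys_below (Suc k)) = (\<Sum>V\<in>(polys_below (Suc k) :: 'a poly set). 1)"
      by (intro sum.cong) auto
    then show ?thesis using True by (simp only: sum_constant card_polys_below) simp
  next
    case False
    have "\<exists>V\<in>polys_below (Suc k). F V \<noteq> 1"
    proof (cases "u \<in> polys_below (Suc m)")
      case True
      then have "coeff u m - 1 \<noteq> 0" using False by (simp add: monics_deg_eq)
      then obtain c where c: "e_p (c * (coeff u m - 1)) \<noteq> 1" using e_p_mult_nontrivial by blast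
      have "monom c k \<in> polys_below (Suc k)" by (simp add: polys_below_def)
      moreover from F_low[OF True this] have "F (monom c k) \<noteq> 1" using c by (simp add: mult.commute)
      ultimately show ?thesis by blast
    next
      case False
      then have u0: "u \<noteq> 0" "degree u > m" by (auto simp: polys_below_iff)
      then have du: "degree u < ?d" using assms(3) by (simp add: polys_below_iff)
      define j where "j = ?d - 1 - degree u"
      have j: "j < k" "degree u + j = ?d - 1" "degree u + j < ?d" using u0 du k by (auto simp: j_def)
      obtain c where c: "e_p (c * lead_coeff u) \<noteq> 1" using u0 e_p_mult_nontrivial[of "lead_coeff u"] by auto
      have "degree (u * monom c j) < ?d"
        using j degree_monom_le[of c j] by (intro le_less_trans[OF degree_mult_le]) linarith
      then have b: "u * monom c j \<in> polys_below ?d" by (simp add: polys_below_iff)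
      have "coeff (u * monom c j) (?d - 1) = c * lead_coeff u"
        unfolding j(2)[symmetric] by (subst mult.commute) (simp add: coeff_monom_mult)
      then have "F (monom c j) \<noteq> 1"
        using c j(1) poly_char_eq[OF assms(1) b] by (simp add: F_def)
      moreover have "monom c j \<in> polys_below (Suc k)" using j(1) by (simp add: polys_below_def)
      ultimately show ?thesis by blast
    qed
    then obtain W where "W \<in> polys_below (Suc k)" "F W \<noteq> 1" by blast
    then have "sum F (polys_below (Suc k)) = 0"
      by (intro sum_character_eq_0[where v = W and c = "F W"]) (auto simp: F_add polys_below_add polys_below_diff)
    with False show ?thesis by simp
  qed
  then show ?thesis by (simp add: F_def k)
qed

definition raw_gauss_sum :: "'a::{field,finite} poly \<Rightarrow> 'a poly \<Rightarrow> complex" where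
  "raw_gauss_sum V h = (\<Sum>u\<in>polys_below (degree h). psi h u * poly_char h (u * V))"

lemma gauss_sum_eq:
  fixes h V :: "'a::{field,finite} poly"
  assumes "h \<noteq> 0"
  shows "gauss_sum V h = cnj (eps_q TYPE('a)) ^ (degree h mod 2) * raw_gauss_sum V h"
  by (simp add: gauss_sum_def raw_gauss_sum_def range_mod_eq_polys_below[OF assms] poly_char_def)

lemma raw_gauss_sum_smult:
  fixes h V :: "'a::{field,finite} poly"
  assumes "odd CARD('a)" "h \<noteq> 0" "c \<noteq> 0"
  shows "raw_gauss_sum (smult c V) h = of_int (quad_sign c) ^ degree h * raw_gauss_sum V h"
proof -
  let ?e = "of_int (quad_sign c) ^ degree h :: complex"
  have e: "?e * ?e = 1"
    by (simp add: power_mult_distrib[symmetric] quad_sign_square flip: of_int_mult)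
  have "raw_gauss_sum V h = (\<Sum>u\<in>polys_below (degree h). psi h (smult c u) * poly_char h (smult c u * V))"
    unfolding raw_gauss_sum_def
    by (rule sum.reindex_bij_witness[of _ "smult c" "smult (inverse c)"])
       (use assms(3) in \<open>auto simp: polys_below_smult\<close>)
  also have "\<dots> = ?e * raw_gauss_sum (smult c V) h"
    using assms by (simp add: psi_smult raw_gauss_sum_def sum_distrib_left mult.assoc)
  finally show ?thesis using e by (simp add: mult.assoc[symmetric])
qed

lemma sum_polys_below_monic:
  fixes F :: "'a::{field,finite} poly \<Rightarrow> 'b::comm_monoid_add"
  shows "sum F (polys_below (Suc k))
       = F 0 + (\<Sum>V\<in>monics_deg_le (int k). \<Sum>c\<in>UNIV - {0}. F (smult c V))"
proof -
  have "sum F (polys_below (Suc k)) = F 0 + sum F (polys_below (Suc k) - {0})"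
    by (subst sum.remove[of _ 0]) auto
  also have "sum F (polys_below (Suc k) - {0})
      = (\<Sum>(V, c)\<in>monics_deg_le (int k) \<times> (UNIV - {0}). F (smult c V))"
    by (rule sum.reindex_bij_witness[of _ "\<lambda>(V, c). smult c V" "\<lambda>V. (smult (inverse (lead_coeff V)) V, lead_coeff V)"])
       (auto simp: monics_deg_le_def polys_below_iff)
  finally show ?thesis by (simp add: sum.cartesian_product)
qed

lemma monics_deg_le_split:
  "monics_deg_le n = monics_deg n \<union> monics_deg_le (n - 1)"
  "monics_deg n \<inter> monics_deg_le (n - 1) = {}"
  by (auto simp: monics_deg_le_def monics_deg_def)

lemma finite_monics_deg_le [simp]: "finite (monics_deg_le n :: 'a::{field,finite} poly set)"
  by (rule finite_subset[OF _ finite_polys_below[of "Suc (nat n)"]])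
     (auto simp: monics_deg_le_def polys_below_iff)

lemma finite_monics_deg [simp]: "finite (monics_deg n :: 'a::{field,finite} poly set)"
  using finite_subset[OF _ finite_monics_deg_le[of n]] monics_deg_le_split(1)[of n] by blast

lemma card_monics_deg: "card (monics_deg (int n) :: 'a::{field,finite} poly set) = CARD('a) ^ n"
proof -
  have n: "n \<le> i \<longleftrightarrow> i = n \<or> Suc n \<le> i" for i by auto
  have mem: "f \<in> monics_deg (int n) \<longleftrightarrow> f - monom 1 n \<in> polys_below n" for f :: "'a poly"
    by (auto simp: monics_deg_eq polys_below_def n)
  have "bij_betw (\<lambda>f. f - monom 1 n) (monics_deg (int n)) (polys_below n :: 'a poly set)"
    by (rule bij_betw_byWitness[of _ "\<lambda>f. f + monom 1 n"]) (auto simp: mem)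
  then show ?thesis using bij_betw_same_card card_polys_below by metis
qed

lemma raw_gauss_sum_0: "raw_gauss_sum 0 h = (\<Sum>u\<in>polys_below (degree h). psi h u)"
  by (simp add: raw_gauss_sum_def)

lemma raw_gauss_sum_0_odd:
  fixes h :: "'a::{field,finite} poly"
  assumes "odd CARD('a)" "h \<noteq> 0" "odd (degree h)"
  shows "raw_gauss_sum 0 h = 0"
proof -
  obtain e :: 'a where e: "e \<noteq> 0" "quad_sign e = -1"
    using quad_sign_minus_1_exists[OF assms(1)] by blast
  show ?thesis using raw_gauss_sum_smult[OF assms(1,2) e(1), of 0] assms(3) e(2) by simp
qed

lemma sum_psi_monics_deg_ge:
  fixes h :: "'a::{field,finite} poly"
  assumes "monic h" "degree h \<le> m"
  shows "(\<Sum>H\<in>monics_deg (int m). psi h H) = of_nat (CARD('a) ^ (m - degree h)) * raw_gauss_sum 0 h"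
proof -
  have h0: "h \<noteq> 0" using assms(1) by auto
  let ?n = "m - degree h"
  have aux: "Q * h + u \<in> monics_deg (int m)" "(Q * h + u) div h = Q" "(Q * h + u) mod h = u"
    if "Q \<in> monics_deg (int ?n)" "u \<in> polys_below (degree h)" for Q u
  proof -
    have u: "u = 0 \<or> degree u < degree h" using that(2) by (simp add: polys_below_iff)
    have Q: "monic Q" "degree Q = ?n" using that(1) by (auto simp: monics_deg_def)
    then have dQ: "degree (Q * h) = m" using assms h0 by (subst degree_mult_eq) auto
    have "monic (Q * h)" using Q assms(1) by (simp add: lead_coeff_mult)
    with u dQ assms(2) show "Q * h + u \<in> monics_deg (int m)"
      by (auto simp: monics_deg_def degree_add_eq_left coeff_eq_0)
    have u': "u div h = 0" "u mod h = u" using u by (auto simp: div_poly_less mod_poly_less)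
    then show "(Q * h + u) div h = Q" "(Q * h + u) mod h = u" using h0 by (auto simp: mod_mult_self4)
  qed
  have aux2: "H div h \<in> monics_deg (int ?n)" if "H \<in> monics_deg (int m)" for H
  proof -
    have H: "monic H" "degree H = m" using that by (auto simp: monics_deg_def)
    have r: "H mod h = 0 \<or> degree (H mod h) < degree h" using degree_mod_less'[OF h0] by blast
    have eq: "H = H div h * h + H mod h" by simp
    have "H div h \<noteq> 0"
    proof
      assume "H div h = 0"
      then have "H = H mod h" using eq by simp
      with r H assms(2) show False by auto
    qed
    then have d: "degree (H div h * h) = degree (H div h) + degree h" using h0 by (simp add: degree_mult_eq)
    have "degree H = degree (H div h * h) \<and> lead_coeff H = lead_coeff (H div h * h)"
    proof (cases "H mod h = 0")
      case False
      then have "degree (H mod h) < degree (H div h * h)" using r d by simp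
      then have "degree (H div h * h + H mod h) = degree (H div h * h)"
        "coeff (H div h * h + H mod h) (degree (H div h * h)) = lead_coeff (H div h * h)"
        by (simp_all only: degree_add_eq_left coeff_add coeff_eq_0 add_0_right)
      then show ?thesis by simp
    qed (use eq in simp)
    moreover have "lead_coeff (H div h * h) = lead_coeff (H div h)"
      unfolding lead_coeff_mult using assms(1) by simp
    ultimately show ?thesis using d H assms(2) by (auto simp: monics_deg_def)
  qed
  have "(\<Sum>H\<in>monics_deg (int m). psi h H)
      = (\<Sum>(Q, u)\<in>(monics_deg (int ?n) :: 'a poly set) \<times> polys_below (degree h). psi h u)"
  proof (rule sum.reindex_bij_witness[of _ "\<lambda>(Q, u). Q * h + u" "\<lambda>H. (H div h, H mod h)"])
    fix H :: "'a poly" assume "H \<in> monics_deg (int m)"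
    then show "(H div h, H mod h) \<in> monics_deg (int ?n) \<times> polys_below (degree h)"
      using aux2 mod_in_polys_below[OF h0] by simp
    show "(case (H div h, H mod h) of (Q, u) \<Rightarrow> psi h u) = psi h H"
      by (auto intro: psi_cong)
  qed (auto simp: aux polys_below_iff mod_poly_less)
  also have "\<dots> = of_nat (CARD('a) ^ ?n) * raw_gauss_sum 0 h"
    by (simp add: sum.cartesian_product[symmetric] card_monics_deg raw_gauss_sum_0)
  finally show ?thesis .
qed

lemma sum_psi_monics_deg_less:
  fixes h :: "'a::{field,finite} poly"
  assumes "odd CARD('a)" "monic h" "m < degree h"
  defines "k \<equiv> degree h - m - 1"
  shows "of_nat (CARD('a) ^ (degree h - m)) * (\<Sum>H\<in>monics_deg (int m). psi h H)
    = raw_gauss_sum 0 h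
      + (\<Sum>V\<in>monics_deg_le (int k).
          (\<Sum>c\<in>UNIV - {0::'a}. of_int (quad_sign c) ^ degree h * e_p (- (c * coeff V k))) * raw_gauss_sum V h)"
proof -
  let ?d = "degree h" and ?M = "monics_deg (int m) :: 'a poly set"
  let ?N = "of_nat (CARD('a) ^ (?d - m)) :: complex"
  have h0: "h \<noteq> 0" using assms(2) by auto
  have k: "?d - m = Suc k" using assms(3) by (simp add: k_def)
  have orth: "(\<Sum>V\<in>polys_below (Suc k). poly_char h (u * V) * e_p (- coeff V k)) = (if u \<in> ?M then ?N else 0)"
    if "u \<in> polys_below ?d" for u
    using orthogonality_monics_deg[OF assms(2,3) that] unfolding k_def[symmetric] unfolding k .
  have "?M \<subseteq> polys_below ?d"
    using assms(3) by (auto simp: monics_deg_def polys_below_iff)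
  then have "?N * (\<Sum>H\<in>?M. psi h H) = (\<Sum>u\<in>polys_below ?d. psi h u * (if u \<in> ?M then ?N else 0))"
    unfolding sum_distrib_left
    by (intro sum.mono_neutral_cong_left) (auto simp: mult.commute)
  also have "\<dots> = (\<Sum>u\<in>polys_below ?d. psi h u *
      (\<Sum>V\<in>polys_below (Suc k). poly_char h (u * V) * e_p (- coeff V k)))"
    using orth by (intro sum.cong refl) simp
  also have "\<dots> = (\<Sum>V\<in>polys_below (Suc k). e_p (- coeff V k) * raw_gauss_sum V h)"
    unfolding raw_gauss_sum_def sum_distrib_left by (subst sum.swap) (simp add: mult_ac)
  also have "\<dots> = raw_gauss_sum 0 h + (\<Sum>V\<in>monics_deg_le (int k). \<Sum>c\<in>UNIV - {0}.
      e_p (- coeff (smult c V) k) * raw_gauss_sum (smult c V) h)"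
    by (subst sum_polys_below_monic) simp
  also have "(\<Sum>V\<in>monics_deg_le (int k). \<Sum>c\<in>UNIV - {0}.
      e_p (- coeff (smult c V) k) * raw_gauss_sum (smult c V) h)
    = (\<Sum>V\<in>monics_deg_le (int k). (\<Sum>c\<in>UNIV - {0::'a}.
        of_int (quad_sign c) ^ degree h * e_p (- (c * coeff V k))) * raw_gauss_sum V h)"
    by (simp add: raw_gauss_sum_smult[OF assms(1) h0] sum_distrib_right sum_distrib_left mult_ac)
  finally show ?thesis .
qed

lemma of_nat_power_div_pabs_ge:
  fixes h :: "'a::{field,finite} poly"
  assumes "degree h \<le> m"
  shows "of_nat (CARD('a) ^ m) / of_nat (pabs h) = (of_nat (CARD('a) ^ (m - degree h)) :: complex)"
proof -
  have "CARD('a) ^ m = CARD('a) ^ (m - degree h) * pabs h"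
    using assms by (simp add: pabs_def flip: power_add)
  then show ?thesis by (simp add: pabs_def)
qed

lemma of_nat_power_div_pabs_less:
  fixes h :: "'a::{field,finite} poly"
  assumes "m < degree h"
  shows "of_nat (CARD('a) ^ m) / of_nat (pabs h) = (1 / of_nat (CARD('a) ^ (degree h - m)) :: complex)"
proof -
  have "pabs h = CARD('a) ^ (degree h - m) * CARD('a) ^ m"
    using assms by (simp add: pabs_def flip: power_add)
  then show ?thesis by (simp add: pabs_def)
qed

lemma sum_psi_monics_deg_less_split:
  fixes h :: "'a::{field,finite} poly"
  assumes "odd CARD('a)" "monic h" "m < degree h"
  shows "of_nat (CARD('a) ^ (degree h - m)) * (\<Sum>H\<in>monics_deg (int m). psi h H)
    = raw_gauss_sum 0 h
      + (\<Sum>c\<in>UNIV - {0::'a}. of_int (quad_sign c) ^ degree h * e_p (- c))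
        * (\<Sum>V\<in>monics_deg (int (degree h) - int m - 1). raw_gauss_sum V h)
      + (\<Sum>c\<in>UNIV - {0::'a}. of_int (quad_sign c) ^ degree h)
        * (\<Sum>V\<in>monics_deg_le (int (degree h) - int m - 2). raw_gauss_sum V h)"
proof -
  define k where "k = degree h - m - 1"
  have k: "int (degree h) - int m - 1 = int k" "int (degree h) - int m - 2 = int k - 1"
    using assms(3) by (auto simp: k_def)
  let ?w = "\<lambda>V. (\<Sum>c\<in>UNIV - {0::'a}. of_int (quad_sign c) ^ degree h * e_p (- (c * coeff V k)))"
  have top: "coeff V k = 1" if "V \<in> monics_deg (int k)" for V :: "'a poly"
    using that by (auto simp: monics_deg_def)
  have low: "coeff V k = 0" if "V \<in> monics_deg_le (int k - 1)" for V :: "'a poly"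
    using that by (auto simp: monics_deg_le_def coeff_eq_0)
  have "(\<Sum>V\<in>monics_deg_le (int k). ?w V * raw_gauss_sum V h)
    = (\<Sum>V\<in>monics_deg (int k). ?w V * raw_gauss_sum V h)
      + (\<Sum>V\<in>monics_deg_le (int k - 1). ?w V * raw_gauss_sum V h)"
    by (subst monics_deg_le_split(1), rule sum.union_disjoint) (auto simp: monics_deg_le_split(2))
  then show ?thesis
    using sum_psi_monics_deg_less[OF assms] unfolding k k_def[symmetric]
    by (simp add: top low sum_distrib_left)
qed

lemma sum_psi_monics_deg_even:
  fixes h :: "'a::{field,finite} poly" and m :: nat
  assumes "odd CARD('a)" and "monic h" and "even (degree h)"
  shows "(\<Sum>H\<in>monics_deg (int m). psi h H) =
    of_nat (CARD('a) ^ m) / of_nat (pabs h) *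
      (gauss_sum 0 h
       + (of_nat CARD('a) - 1) *
           (\<Sum>V\<in>monics_deg_le (int (degree h) - int m - 2). gauss_sum V h)
       - (\<Sum>V\<in>monics_deg (int (degree h) - int m - 1). gauss_sum V h))"
proof (cases "m < degree h")
  case False
  have "monics_deg_le (int (degree h) - int m - 2) = ({} :: 'a poly set)"
    "monics_deg (int (degree h) - int m - 1) = ({} :: 'a poly set)"
    using False by (auto simp: monics_deg_le_def monics_deg_def)
  moreover have "h \<noteq> 0" using assms(2) by auto
  ultimately show ?thesis
    using False assms(2,3)
    by (subst of_nat_power_div_pabs_ge) (simp_all add: sum_psi_monics_deg_ge gauss_sum_eq)
next
  case True
  have sgn: "of_int (quad_sign c) ^ degree h = (1 :: complex)" for c :: 'a
    using assms(3) by (simp add: quad_sign_def)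
  have eq: "gauss_sum V h = raw_gauss_sum V h" for V
    using assms(2,3) by (subst gauss_sum_eq) auto
  have "of_nat (CARD('a) ^ (degree h - m)) * (\<Sum>H\<in>monics_deg (int m). psi h H)
      = gauss_sum 0 h
        + (of_nat CARD('a) - 1) * (\<Sum>V\<in>monics_deg_le (int (degree h) - int m - 2). gauss_sum V h)
        - (\<Sum>V\<in>monics_deg (int (degree h) - int m - 1). gauss_sum V h)"
    unfolding sum_psi_monics_deg_less_split[OF assms(1,2) True] sgn eq mult_1 sum_e_p_nonzero
    using card_field_gt_1[where 'a='a] by (simp add: of_nat_diff)
  then show ?thesis
    unfolding of_nat_power_div_pabs_less[OF True] by (simp add: field_simps)
qed

lemma sum_psi_monics_deg_odd:
  fixes h :: "'a::{field,finite} poly" and m :: nat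
  assumes "odd CARD('a)" and "monic h" and "odd (degree h)"
  shows "(\<Sum>H\<in>monics_deg (int m). psi h H) =
    of_nat (CARD('a) ^ m) * of_real (sqrt (real CARD('a))) / of_nat (pabs h) *
      (\<Sum>V\<in>monics_deg (int (degree h) - int m - 1). gauss_sum V h)"
proof (cases "m < degree h")
  case False
  have "monics_deg (int (degree h) - int m - 1) = ({} :: 'a poly set)"
    using False by (auto simp: monics_deg_def)
  moreover have "h \<noteq> 0" using assms(2) by auto
  ultimately show ?thesis
    using False assms by (simp add: sum_psi_monics_deg_ge raw_gauss_sum_0_odd)
next
  case True
  have h0: "h \<noteq> 0" using assms(2) by auto
  have sgn: "of_int (quad_sign c) ^ degree h = (of_int (quad_sign c) :: complex)" for c :: 'a
    using assms(3) by (simp add: quad_sign_def)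
  have eq: "gauss_sum V h = cnj (eps_q TYPE('a)) * raw_gauss_sum V h" for V
    using assms(3) h0 by (simp add: gauss_sum_eq odd_iff_mod_2_eq_one)
  have "of_nat (CARD('a) ^ (degree h - m)) * (\<Sum>H\<in>monics_deg (int m). psi h H)
      = of_real (sqrt (real CARD('a))) * (\<Sum>V\<in>monics_deg (int (degree h) - int m - 1). gauss_sum V h)"
    unfolding sum_psi_monics_deg_less_split[OF assms(1,2) True] sgn eq sum_quad_sign_e_p_minus
      sum_quad_sign[OF assms(1)] raw_gauss_sum_0_odd[OF assms(1) h0 assms(3)]
    by (simp add: sum_distrib_left mult.assoc)
  then have "(\<Sum>H\<in>monics_deg (int m). psi h H) = of_real (sqrt (real CARD('a))) / of_nat (CARD('a) ^ (degree h - m))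
      * (\<Sum>V\<in>monics_deg (int (degree h) - int m - 1). gauss_sum V h)"
    by (simp add: field_simps)
  also have "of_real (sqrt (real CARD('a))) / of_nat (CARD('a) ^ (degree h - m))
      = (of_nat (CARD('a) ^ m) * of_real (sqrt (real CARD('a))) / of_nat (pabs h) :: complex)"
    unfolding times_divide_eq_left[symmetric] of_nat_power_div_pabs_less[OF True] by simp
  finally show ?thesis .
qed

theorem proposition2p9:
  fixes h :: "'a::{field,finite} poly" and m :: nat
  assumes "odd CARD('a)" and "monic h"
  shows "(even (degree h) \<longrightarrow>
      (\<Sum>H\<in>monics_deg (int m). psi h H) =
        of_nat (CARD('a) ^ m) / of_nat (pabs h) *
          (gauss_sum 0 h
           + (of_nat CARD('a) - 1) *
               (\<Sum>V\<in>monics_deg_le (int (degree h) - int m - 2). gauss_sum V h)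
           - (\<Sum>V\<in>monics_deg (int (degree h) - int m - 1). gauss_sum V h))) \<and>
    (odd (degree h) \<longrightarrow>
      (\<Sum>H\<in>monics_deg (int m). psi h H) =
        of_nat (CARD('a) ^ m) * of_real (sqrt (real CARD('a))) / of_nat (pabs h) *
          (\<Sum>V\<in>monics_deg (int (degree h) - int m - 1). gauss_sum V h))"
  using sum_psi_monics_deg_even[OF assms] sum_psi_monics_deg_odd[OF assms] by blast

end
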